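(* The quotient spaces $2^\omega/\!=^e$ and $2^\omega/\!=^f$ (each with the quotient topology induced from Cantor space) are not homeomorphic.
   Context: Fix a computable pairing bijection $\langle\cdot,\cdot\rangle:\omega^2\to\omega$. For $A\subseteq\omega$, let $\pi_1(A)=\{x:\exists y\,\langle x,y\rangle\in A\}$ and let the $x$-th column be $A^{[x]}=\{y:\langle x,y\rangle\in A\}$. Define $A=^eB$ iff $\pi_1(A)=\pi_1(B)$, and $A=^fB$ iff for all $x$, $|A^{[x]}|=|B^{[x]}|$ (cardinalities in $\omega\cup\{\omega\}$). Cantor space $2^\omega$ has basic open sets $\{h:\sigma\subset h\}$, $\sigma\in2^{<\omega}$. ($2^\omega/\!=^e$ is homeomorphic to the Scott topology on $2^\omega$, whose basic open sets are $\{h: F\subseteq h^{-1}(1)\}$ for finite $F\subseteq\omega$.) *)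

theory Defs
  imports "HOL-Analysis.Analysis" "HOL-Library.Equipollence"
begin

text \<open>A point of Cantor space is a subset of the natural numbers, identified with its
  characteristic function; a finite binary string is a \<^typ>\<open>bool list\<close>.\<close>

definition cylinder :: "bool list \<Rightarrow> nat set set" where
  "cylinder \<sigma> = {A. \<forall>i < length \<sigma>. i \<in> A \<longleftrightarrow> \<sigma> ! i}"

definition cantor_space :: "nat set topology" where
  "cantor_space = topology_generated_by (range cylinder)"

text \<open>The library's generated topology takes its argument as a subbase. The next lemma says that
  the cylinders are in fact a base.\<close>

lemma cylinder_restrict: "A \<in> cylinder (map (\<lambda>i. i \<in> A) [0..<n])"
  by (simp add: cylinder_def)

lemma openin_cantor_space:
  "openin cantor_space U \<longleftrightarrow> (\<forall>A\<in>U. \<exists>\<sigma>. A \<in> cylinder \<sigma> \<and> cylinder \<sigma> \<subseteq> U)"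
proof
  assume "openin cantor_space U"
  then have "generate_topology_on (range cylinder) U"
    by (simp add: cantor_space_def openin_topology_generated_by_iff)
  then show "\<forall>A\<in>U. \<exists>\<sigma>. A \<in> cylinder \<sigma> \<and> cylinder \<sigma> \<subseteq> U"
  proof induction
    case (Int a b)
    show ?case
    proof
      fix A assume "A \<in> a \<inter> b"
      with Int obtain s t where st: "A \<in> cylinder s" "cylinder s \<subseteq> a" "A \<in> cylinder t" "cylinder t \<subseteq> b"
        by blast
      define u where "u = map (\<lambda>i. i \<in> A) [0..<max (length s) (length t)]"
      have "cylinder u \<subseteq> cylinder s \<inter> cylinder t"
        using st(1,3) by (auto simp: u_def cylinder_def)
      then show "\<exists>\<sigma>. A \<in> cylinder \<sigma> \<and> cylinder \<sigma> \<subseteq> a \<inter> b"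
        using st cylinder_restrict u_def by blast
    qed
  next
    case (UN K)
    then show ?case by (meson Union_iff Union_upper subset_trans)
  qed auto
next
  assume *: "\<forall>A\<in>U. \<exists>\<sigma>. A \<in> cylinder \<sigma> \<and> cylinder \<sigma> \<subseteq> U"
  have "openin cantor_space (cylinder \<sigma>)" for \<sigma>
    by (simp add: cantor_space_def topology_generated_by_Basis)
  with * show "openin cantor_space U"
    by (subst openin_subopen) blast
qed

lemma topspace_cantor_space [simp]: "topspace cantor_space = UNIV"
proof -
  have "openin cantor_space UNIV"
    unfolding openin_cantor_space using cylinder_restrict by blast
  then show ?thesis
    using openin_subset by blast
qed

text \<open>The points are the equivalence classes \<^term>\<open>r `` {x}\<close>, and a set of classes is open iff its
  preimage under the projection is open.\<close>

definition quotient_topology :: "'a topology \<Rightarrow> ('a \<times> 'a) set \<Rightarrow> 'a set topology" where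
  "quotient_topology X r =
     topology (\<lambda>U. U \<subseteq> topspace X // r \<and> openin X {x \<in> topspace X. r `` {x} \<in> U})"

lemma openin_quotient_topology:
  "openin (quotient_topology X r) U \<longleftrightarrow>
     U \<subseteq> topspace X // r \<and> openin X {x \<in> topspace X. r `` {x} \<in> U}"
proof -
  have "istopology (\<lambda>U. U \<subseteq> topspace X // r \<and> openin X {x \<in> topspace X. r `` {x} \<in> U})"
    unfolding istopology_def
  proof (intro conjI allI impI; (elim conjE)?)
    fix S T
    assume "openin X {x \<in> topspace X. r `` {x} \<in> S}" "openin X {x \<in> topspace X. r `` {x} \<in> T}"
    then have "openin X ({x \<in> topspace X. r `` {x} \<in> S} \<inter> {x \<in> topspace X. r `` {x} \<in> T})"
      by blast
    then show "openin X {x \<in> topspace X. r `` {x} \<in> S \<inter> T}"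
      by (rule back_subst[of "openin X"]) auto
  next
    fix K
    assume "\<forall>S\<in>K. S \<subseteq> topspace X // r \<and> openin X {x \<in> topspace X. r `` {x} \<in> S}"
    then have "openin X (\<Union>S\<in>K. {x \<in> topspace X. r `` {x} \<in> S})"
      by blast
    then show "openin X {x \<in> topspace X. r `` {x} \<in> \<Union>K}"
      by (rule back_subst[of "openin X"]) auto
  qed blast+
  then show ?thesis
    by (simp add: quotient_topology_def topology_inverse')
qed

lemma topspace_quotient_topology [simp]: "topspace (quotient_topology X r) = topspace X // r"
proof -
  have "{x \<in> topspace X. r `` {x} \<in> topspace X // r} = topspace X"
    by (auto intro: quotientI)
  then have "openin (quotient_topology X r) (topspace X // r)"
    by (simp add: openin_quotient_topology)
  then show ?thesis
    by (metis openin_quotient_topology openin_subset openin_topspace subset_antisym)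
qed

lemma quotient_map_quotient_topology:
  "quotient_map X (quotient_topology X r) (\<lambda>x. r `` {x})"
  by (auto simp: quotient_map_def openin_quotient_topology quotient_def)

text \<open>The parameter \<open>pr\<close> is the pairing function. It is only ever assumed to be a bijection, which
  includes every computable choice.\<close>

definition proj1 :: "(nat \<times> nat \<Rightarrow> nat) \<Rightarrow> nat set \<Rightarrow> nat set" where
  "proj1 pr A = {x. \<exists>y. pr (x, y) \<in> A}"

definition column :: "(nat \<times> nat \<Rightarrow> nat) \<Rightarrow> nat set \<Rightarrow> nat \<Rightarrow> nat set" where
  "column pr A x = {y. pr (x, y) \<in> A}"

definition eq_e :: "(nat \<times> nat \<Rightarrow> nat) \<Rightarrow> (nat set \<times> nat set) set" where
  "eq_e pr = {(A, B). proj1 pr A = proj1 pr B}"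

text \<open>Equality of cardinalities is equipollence, so all infinite columns have the same cardinality.
  (The library's \<^const>\<open>card\<close> would identify infinite columns with the empty one.)\<close>

definition eq_f :: "(nat \<times> nat \<Rightarrow> nat) \<Rightarrow> (nat set \<times> nat set) set" where
  "eq_f pr = {(A, B). \<forall>x. column pr A x \<approx> column pr B x}"

lemma equiv_eq_e: "equiv UNIV (eq_e pr)"
  by (auto simp: eq_e_def intro!: equivI refl_onI symI transI)

lemma equiv_eq_f: "equiv UNIV (eq_f pr)"
  by (auto simp: eq_f_def intro!: equivI refl_onI symI transI intro: eqpoll_sym eqpoll_trans)

end

theory Submission
  imports Defs
begin

text \<open>In both quotients the closure of a point is its down-set in the specialization order. For
  \<open>=\<^sup>e\<close> this order is inclusion of first projections, so a finite closure of a
  point is a power set and has \<open>2 ^ k\<close> elements. For \<open>=\<^sup>f\<close> it is the pointwise order of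
  column cardinalities, so the class of a set consisting of two elements of one column has a
  closure with exactly three points. A homeomorphism would preserve this number.\<close>

section \<open>Cantor space and closures of points in its quotients\<close>

text \<open>Cylinders are replaced by agreement below a bound \<open>n\<close>: in the closure
  arguments, elements from \<open>n\<close> on can then be changed freely without leaving a
  neighbourhood.\<close>

lemma openin_cantor_space_iff:
  "openin cantor_space V \<longleftrightarrow>
     (\<forall>A\<in>V. \<exists>n. \<forall>B. B \<inter> {..<n} = A \<inter> {..<n} \<longrightarrow> B \<in> V)"
proof -
  have "(\<exists>\<sigma>. A \<in> cylinder \<sigma> \<and> cylinder \<sigma> \<subseteq> V) \<longleftrightarrow>
        (\<exists>n. \<forall>B. B \<inter> {..<n} = A \<inter> {..<n} \<longrightarrow> B \<in> V)" (is "?L \<longleftrightarrow> ?R") for A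
  proof
    assume ?L
    then obtain \<sigma> where \<sigma>: "A \<in> cylinder \<sigma>" "cylinder \<sigma> \<subseteq> V" by blast
    have "B \<in> cylinder \<sigma>" if "B \<inter> {..<length \<sigma>} = A \<inter> {..<length \<sigma>}" for B
      using that \<sigma>(1) by (auto simp: cylinder_def set_eq_iff)
    with \<sigma>(2) show ?R by blast
  next
    assume ?R
    then obtain n where n: "\<And>B. B \<inter> {..<n} = A \<inter> {..<n} \<Longrightarrow> B \<in> V" by blast
    have "cylinder (map (\<lambda>i. i \<in> A) [0..<n]) \<subseteq> V"
      by (auto simp: cylinder_def intro!: n)
    then show ?L using cylinder_restrict by blast
  qed
  then show ?thesis
    by (simp add: openin_cantor_space)
qed

lemma openin_cantor_space_supersets:
  assumes "finite F"
  shows "openin cantor_space {C. F \<subseteq> C}"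
proof -
  obtain n where "F \<subseteq> {..<n}"
    using assms finite_nat_iff_bounded by blast
  then show ?thesis
    unfolding openin_cantor_space_iff by blast
qed

lemma in_closure_of_quotient_singleton:
  assumes r: "equiv (topspace X) r" and A: "A \<in> topspace X" and B: "B \<in> topspace X"
  shows "r `` {B} \<in> quotient_topology X r closure_of {r `` {A}} \<longleftrightarrow>
     (\<forall>V. openin X V \<longrightarrow> r `` V \<subseteq> V \<longrightarrow> B \<in> V \<longrightarrow> A \<in> V)" (is "?L \<longleftrightarrow> ?R")
proof
  assume ?L
  show ?R
  proof (intro allI impI)
    fix V assume V: "openin X V" "r `` V \<subseteq> V" "B \<in> V"
    let ?U = "(\<lambda>x. r `` {x}) ` V"
    have sub: "V \<subseteq> topspace X"
      using V(1) openin_subset by blast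
    have pre: "{x \<in> topspace X. r `` {x} \<in> ?U} = V"
    proof (intro equalityI subsetI)
      fix x assume "x \<in> {x \<in> topspace X. r `` {x} \<in> ?U}"
      then obtain v where "x \<in> topspace X" "v \<in> V" "r `` {x} = r `` {v}" by blast
      then have "x \<in> r `` {v}"
        using equiv_class_self[OF r] by metis
      with \<open>v \<in> V\<close> V(2) show "x \<in> V" by blast
    next
      fix x assume "x \<in> V"
      then show "x \<in> {x \<in> topspace X. r `` {x} \<in> ?U}"
        using subsetD[OF sub] imageI[of x V "\<lambda>x. r `` {x}"] by simp
    qed
    have "openin (quotient_topology X r) ?U"
      unfolding openin_quotient_topology pre using V(1) sub by (auto intro: quotientI)
    moreover have "r `` {B} \<in> ?U"
      using V(3) by (rule imageI)
    ultimately have "r `` {A} \<in> ?U"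
      using \<open>?L\<close> unfolding in_closure_of by (metis singletonD)
    with pre A show "A \<in> V" by blast
  qed
next
  assume R: ?R
  have "r `` {A} \<in> U" if U: "openin (quotient_topology X r) U" "r `` {B} \<in> U" for U
  proof -
    let ?V = "{x \<in> topspace X. r `` {x} \<in> U}"
    have "openin X ?V"
      using U(1) by (simp add: openin_quotient_topology)
    moreover have "r `` ?V \<subseteq> ?V"
    proof clarify
      fix x y assume "(x, y) \<in> r" "r `` {x} \<in> U" "x \<in> topspace X"
      then show "y \<in> topspace X \<and> r `` {y} \<in> U"
        using equiv_class_eq[OF r] eq_equiv_class_iff2 equiv_class_eq_iff[OF r] by metis
    qed
    ultimately show ?thesis
      using R B U(2) by blast
  qed
  with B show ?L
    unfolding in_closure_of by (auto intro: quotientI)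
qed

text \<open>This is the invariant that separates the two spaces. Infinite closures are covered too,
  since \<open>card\<close> is then 0 on both sides.\<close>

lemma homeomorphic_map_card_closure_of_singleton:
  assumes "homeomorphic_map X Y h" "p \<in> topspace X"
  shows "card (Y closure_of {h p}) = card (X closure_of {p})"
proof -
  have "Y closure_of (h ` {p}) = h ` (X closure_of {p})"
    using assms by (intro homeomorphic_map_closure_of) auto
  moreover have "inj_on h (X closure_of {p})"
    using assms(1) closure_of_subset_topspace inj_on_subset
    by (metis homeomorphic_map_def homeomorphic_imp_injective_map)
  ultimately show ?thesis
    by (simp add: card_image)
qed

text \<open>Injectivity leaves only finitely many elements of column \<open>x\<close> with a code
  below \<open>n\<close>. The lemma supplies new column elements that a given neighbourhood cannot
  see.\<close>

lemma ex_pair_ge: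
  fixes pr :: "nat \<times> nat \<Rightarrow> nat"
  assumes "inj pr" "finite S"
  obtains y where "y \<notin> S" "n \<le> pr (x, y)"
proof -
  have "inj (\<lambda>y. pr (x, y))"
    by (rule injI) (simp add: inj_eq[OF assms(1)])
  then have "finite ((\<lambda>y. pr (x, y)) -` {..<n})"
    by (rule finite_vimageI[OF finite_lessThan])
  with assms(2) have "finite (S \<union> (\<lambda>y. pr (x, y)) -` {..<n})" by simp
  then obtain y where "y \<notin> S \<union> (\<lambda>y. pr (x, y)) -` {..<n}"
    using ex_new_if_finite infinite_UNIV_nat by blast
  then show thesis
    using that by auto
qed

section \<open>The quotient by \<open>eq_e\<close>: closures are power sets\<close>

lemma eq_e_in_closure_of_iff:
  assumes "inj pr"
  shows "eq_e pr `` {B} \<in> quotient_topology cantor_space (eq_e pr) closure_of {eq_e pr `` {A}} \<longleftrightarrow>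
     proj1 pr B \<subseteq> proj1 pr A" (is "?L \<longleftrightarrow> ?R")
proof -
  have L: "?L \<longleftrightarrow> (\<forall>V. openin cantor_space V \<longrightarrow> eq_e pr `` V \<subseteq> V \<longrightarrow> B \<in> V \<longrightarrow> A \<in> V)"
    by (intro in_closure_of_quotient_singleton) (auto simp: equiv_eq_e)
  show ?thesis
  proof
    assume ?L
    show ?R
    proof
      fix x assume x: "x \<in> proj1 pr B"
      \<comment> \<open>A saturated open set that tests whether \<open>x\<close> lies in the
        projection.\<close>
      let ?V = "\<Union>y. {C. {pr (x, y)} \<subseteq> C}"
      have V: "?V = {C. x \<in> proj1 pr C}"
        by (auto simp: proj1_def)
      have "openin cantor_space ?V"
        by (auto intro!: openin_Union simp del: singleton_insert_inj_eq insert_subset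
            intro: openin_cantor_space_supersets)
      moreover have "eq_e pr `` ?V \<subseteq> ?V"
        unfolding V by (auto simp: eq_e_def)
      ultimately show "x \<in> proj1 pr A"
        using \<open>?L\<close> x unfolding L V by blast
    qed
  next
    assume R: ?R
    show ?L
      unfolding L
    proof (intro allI impI)
      fix V assume V: "openin cantor_space V" "eq_e pr `` V \<subseteq> V" "B \<in> V"
      then obtain n where n: "\<And>C. C \<inter> {..<n} = B \<inter> {..<n} \<Longrightarrow> C \<in> V"
        unfolding openin_cantor_space_iff by blast
      \<comment> \<open>\<open>C\<close> looks like \<open>B\<close> below \<open>n\<close>, so it
        stays in \<open>V\<close>. The codes added from \<open>n\<close> on meet every column
        indexed by \<open>proj1 pr A\<close>, which makes \<open>C\<close> equivalent to
        \<open>A\<close>.\<close>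
      define C where "C = B \<inter> {..<n} \<union> {pr (x, y) |x y. x \<in> proj1 pr A \<and> n \<le> pr (x, y)}"
      have "C \<in> V"
        by (intro n) (auto simp: C_def)
      moreover have "proj1 pr C = proj1 pr A"
      proof
        show "proj1 pr C \<subseteq> proj1 pr A"
          using R by (auto simp: proj1_def C_def inj_eq[OF assms])
        show "proj1 pr A \<subseteq> proj1 pr C"
        proof
          fix x assume "x \<in> proj1 pr A"
          moreover obtain y where "n \<le> pr (x, y)"
            using ex_pair_ge[OF assms finite.emptyI] by blast
          ultimately have "pr (x, y) \<in> C"
            by (auto simp: C_def)
          then show "x \<in> proj1 pr C"
            by (auto simp: proj1_def)
        qed
      qed
      ultimately show "A \<in> V"
        using V(2) by (auto simp: eq_e_def)
    qed
  qed
qed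

text \<open>The closure is in bijection with the power set of \<open>proj1 pr A\<close>, whose
  \<open>card\<close> is a power of 2, or 0 in the infinite case.\<close>

lemma eq_e_card_closure_of_singleton_ne_3:
  assumes "inj pr"
  shows "card (quotient_topology cantor_space (eq_e pr) closure_of {eq_e pr `` {A}}) \<noteq> 3"
proof -
  let ?cl = "quotient_topology cantor_space (eq_e pr) closure_of {eq_e pr `` {A}}"
  \<comment> \<open>The class with projection \<open>S\<close>, represented by the set having the
    single element 0 in each column indexed by \<open>S\<close>.\<close>
  define g where "g S = eq_e pr `` {(\<lambda>x. pr (x, 0)) ` S}" for S
  have proj_g: "proj1 pr ((\<lambda>x. pr (x, 0)) ` S) = S" for S
    by (auto simp: proj1_def inj_eq[OF assms])
  have g_proj: "g (proj1 pr B) = eq_e pr `` {B}" for B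
    unfolding g_def by (intro equiv_class_eq[OF equiv_eq_e]) (simp add: eq_e_def proj_g)
  have "inj g"
  proof (rule injI)
    fix S T assume "g S = g T"
    then have "((\<lambda>x. pr (x, 0)) ` S, (\<lambda>x. pr (x, 0)) ` T) \<in> eq_e pr"
      unfolding g_def using eq_equiv_class[OF _ equiv_eq_e] by blast
    then show "S = T"
      by (simp add: eq_e_def proj_g)
  qed
  moreover have "?cl = g ` Pow (proj1 pr A)"
  proof
    show "?cl \<subseteq> g ` Pow (proj1 pr A)"
    proof
      fix q assume q: "q \<in> ?cl"
      then have "q \<in> UNIV // eq_e pr"
        using closure_of_subset_topspace by fastforce
      then obtain B where B: "q = eq_e pr `` {B}"
        by (auto elim: quotientE)
      with q have "proj1 pr B \<subseteq> proj1 pr A"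
        by (simp add: eq_e_in_closure_of_iff assms)
      then show "q \<in> g ` Pow (proj1 pr A)"
        using g_proj B by blast
    qed
    show "g ` Pow (proj1 pr A) \<subseteq> ?cl"
      by (auto simp: g_def eq_e_in_closure_of_iff assms proj_g)
  qed
  ultimately have card: "card ?cl = card (Pow (proj1 pr A))"
    by (metis card_image inj_on_subset subset_UNIV)
  show ?thesis
  proof (cases "finite (proj1 pr A)")
    case True
    \<comment> \<open>The power is 1 for \<open>k = 0\<close> and even otherwise.\<close>
    have "(2::nat) ^ k \<noteq> 3" for k
      by (cases k) (simp, simp, presburger)
    with True card show ?thesis
      by (simp add: card_Pow)
  next
    case False
    with card show ?thesis
      by simp
  qed
qed

section \<open>The quotient by \<open>eq_f\<close>: a point whose closure has three elements\<close>

lemma eq_f_in_closure_of_iff: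
  "eq_f pr `` {B} \<in> quotient_topology cantor_space (eq_f pr) closure_of {eq_f pr `` {A}} \<longleftrightarrow>
     (\<forall>V. openin cantor_space V \<longrightarrow> eq_f pr `` V \<subseteq> V \<longrightarrow> B \<in> V \<longrightarrow> A \<in> V)"
  by (intro in_closure_of_quotient_singleton) (auto simp: equiv_eq_f)

text \<open>Having at least \<open>card T\<close> elements in column \<open>x\<close>, for a finite
  \<open>T\<close>, is a saturated open condition, so it passes from \<open>B\<close> to
  \<open>A\<close>. All finite subsets of the column of \<open>B\<close> are therefore bounded in
  size, which makes that column finite.\<close>

lemma eq_f_closure_of_imp_card_column_le:
  assumes "inj pr" "finite (column pr A x)"
    and cl: "eq_f pr `` {B} \<in> quotient_topology cantor_space (eq_f pr) closure_of {eq_f pr `` {A}}"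
  shows "finite (column pr B x) \<and> card (column pr B x) \<le> card (column pr A x)"
proof -
  have bound: "card T \<le> card (column pr A x)" if T: "finite T" "T \<subseteq> column pr B x" for T
  proof -
    \<comment> \<open>The union over all \<open>S\<close> of the size of \<open>T\<close> gives
      saturation; each set in it is open because \<open>S\<close> is finite.\<close>
    let ?V = "\<Union>S\<in>{S. S \<approx> T}. {C. (\<lambda>y. pr (x, y)) ` S \<subseteq> C}"
    have "T \<lesssim> D \<longleftrightarrow> (\<exists>S. S \<approx> T \<and> S \<subseteq> D)" for D :: "nat set"
      by (meson eqpoll_sym inj_on_image_eqpoll_self lepoll_def lepoll_trans1 subset_imp_lepoll)
    then have V: "?V = {C. T \<lesssim> column pr C x}"
      by (auto simp: column_def image_subset_iff subset_iff)
    have "openin cantor_space ?V"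
      using T(1) by (auto intro!: openin_Union openin_cantor_space_supersets simp: eqpoll_finite_iff)
    moreover have "eq_f pr `` ?V \<subseteq> ?V"
      unfolding V by (auto simp: eq_f_def intro: lepoll_trans eqpoll_imp_lepoll)
    ultimately have "A \<in> ?V"
      using cl T(2) subset_imp_lepoll unfolding V eq_f_in_closure_of_iff by blast
    then show ?thesis
      unfolding V using assms(2) T(1) lepoll_iff_card_le by blast
  qed
  then show ?thesis
    by (metis assms(2) finite_if_finite_subsets_card_bdd order_refl)
qed

text \<open>Every neighbourhood of \<open>B\<close> also contains \<open>B\<close> with one new
  element far out in column \<open>x\<close>. Only the sizes of columns count, so this set is
  equivalent to \<open>insert b B\<close>.\<close>

lemma eq_f_insert_in_closure_of:
  assumes "inj pr" "finite B" "b = pr (x, y)" "b \<notin> B"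
  shows "eq_f pr `` {B} \<in>
    quotient_topology cantor_space (eq_f pr) closure_of {eq_f pr `` {insert b B}}"
  unfolding eq_f_in_closure_of_iff
proof (intro allI impI)
  fix V assume V: "openin cantor_space V" "eq_f pr `` V \<subseteq> V" "B \<in> V"
  then obtain n where n: "\<And>C. C \<inter> {..<n} = B \<inter> {..<n} \<Longrightarrow> C \<in> V"
    unfolding openin_cantor_space_iff by blast
  have fin: "finite (column pr C z)" if "finite C" for C z
  proof -
    have "inj (\<lambda>y. pr (z, y))"
      by (rule injI) (simp add: inj_eq[OF assms(1)])
    from finite_vimageI[OF that this] show ?thesis
      by (simp add: column_def vimage_def)
  qed
  \<comment> \<open>The element \<open>z\<close> is new in the column, so the size grows by one, and
    its code is at least \<open>n\<close>, so the neighbourhood does not notice it.\<close>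
  obtain z where z: "z \<notin> column pr B x" "n \<le> pr (x, z)"
    using ex_pair_ge assms(1) fin[OF assms(2)] by metis
  have ins: "column pr (insert (pr (x, u)) B) w =
      (if w = x then insert u (column pr B w) else column pr B w)" for u w
    by (auto simp: column_def inj_eq[OF assms(1)])
  have "y \<notin> column pr B x"
    using assms(3,4) by (simp add: column_def)
  then have "column pr (insert (pr (x, z)) B) w \<approx> column pr (insert (pr (x, y)) B) w" for w
    using z(1) fin[OF assms(2)] by (auto simp: ins insert_eqpoll_cong)
  then have "(insert (pr (x, z)) B, insert b B) \<in> eq_f pr"
    by (simp add: eq_f_def assms(3))
  moreover have "insert (pr (x, z)) B \<in> V"
    using z(2) by (intro n) auto
  ultimately show "insert b B \<in> V"
    using V(2) by blast
qed

text \<open>The three points are the classes with 0, 1 or 2 elements in column 0 and all other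
  columns empty.\<close>

lemma eq_f_card_closure_of_two_element_column:
  assumes "inj pr"
  defines "a \<equiv> pr (0, 0)" and "b \<equiv> pr (0, Suc 0)"
  shows "card (quotient_topology cantor_space (eq_f pr) closure_of {eq_f pr `` {{a, b}}}) = 3"
proof -
  let ?cl = "\<lambda>A. quotient_topology cantor_space (eq_f pr) closure_of {eq_f pr `` {A}}"
  have ab: "a \<noteq> b"
    using assms by (simp add: inj_eq)
  have col: "column pr {} x = {}" "column pr {a} x = (if x = 0 then {0} else {})"
      "column pr {a, b} x = (if x = 0 then {0, Suc 0} else {})" for x
    using assms by (auto simp: column_def inj_eq)
  have eq_iff: "eq_f pr `` {A} = eq_f pr `` {B} \<longleftrightarrow> (\<forall>x. column pr A x \<approx> column pr B x)" for A B
    using eq_equiv_class_iff[OF equiv_eq_f, of A B] by (simp add: eq_f_def)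
  have "?cl {a, b} = {eq_f pr `` {{}}, eq_f pr `` {{a}}, eq_f pr `` {{a, b}}}"
  proof (intro equalityI subsetI)
    fix q assume q: "q \<in> ?cl {a, b}"
    then have "q \<in> UNIV // eq_f pr"
      using closure_of_subset_topspace by fastforce
    then obtain B where B: "q = eq_f pr `` {B}"
      by (auto elim: quotientE)
    have le: "finite (column pr B x) \<and> card (column pr B x) \<le> card (column pr {a, b} x)" for x
      using q B assms(1) by (intro eq_f_closure_of_imp_card_column_le) (auto simp: col)
    have off: "column pr B x = {}" if "x \<noteq> 0" for x
      using le[of x] that by (auto simp: col)
    \<comment> \<open>All columns other than 0 are empty on both sides, so equivalence is decided in
      column 0.\<close>
    have eqv: "(\<forall>x. column pr B x \<approx> column pr D x) \<longleftrightarrow> column pr B 0 \<approx> column pr D 0"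
      if "D \<in> {{}, {a}, {a, b}}" for D
    proof -
      have "column pr D x = {}" if "x \<noteq> 0" for x
        using \<open>D \<in> _\<close> that by (auto simp: col)
      with off show ?thesis
        by (metis eqpoll_refl)
    qed
    have "card (column pr B 0) \<in> {0, 1, 2}"
      using le[of 0] by (simp add: col del: card_0_eq) linarith
    then have "column pr B 0 \<approx> column pr {} 0 \<or>
        column pr B 0 \<approx> column pr {a} 0 \<or> column pr B 0 \<approx> column pr {a, b} 0"
      using le[of 0] by (auto simp: col eqpoll_iff_card)
    then have "(\<forall>x. column pr B x \<approx> column pr {} x) \<or>
        (\<forall>x. column pr B x \<approx> column pr {a} x) \<or> (\<forall>x. column pr B x \<approx> column pr {a, b} x)"
      by (simp add: eqv)
    then show "q \<in> {eq_f pr `` {{}}, eq_f pr `` {{a}}, eq_f pr `` {{a, b}}}"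
      unfolding B by (simp add: eq_iff)
  next
    have up1: "eq_f pr `` {{}} \<in> ?cl {a}"
      using assms(1) by (intro eq_f_insert_in_closure_of) (auto simp: a_def)
    have "eq_f pr `` {{a}} \<in> ?cl {b, a}"
      using assms(1) ab by (intro eq_f_insert_in_closure_of) (auto simp: b_def)
    then have up2: "eq_f pr `` {{a}} \<in> ?cl {a, b}"
      by (simp add: insert_commute)
    \<comment> \<open>The specialization order is transitive: each saturated open set passes from
      \<open>{}\<close> to \<open>{a}\<close> and on to \<open>{a, b}\<close>.\<close>
    have "eq_f pr `` {{}} \<in> ?cl {a, b}"
      using up1 up2 unfolding eq_f_in_closure_of_iff by blast
    moreover have "eq_f pr `` {{a, b}} \<in> ?cl {a, b}"
      unfolding eq_f_in_closure_of_iff by blast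
    moreover fix q assume "q \<in> {eq_f pr `` {{}}, eq_f pr `` {{a}}, eq_f pr `` {{a, b}}}"
    ultimately show "q \<in> ?cl {a, b}"
      using up2 by blast
  qed
  moreover have "eq_f pr `` {{}} \<noteq> eq_f pr `` {{a}}" "eq_f pr `` {{}} \<noteq> eq_f pr `` {{a, b}}"
      "eq_f pr `` {{a}} \<noteq> eq_f pr `` {{a, b}}"
    unfolding eq_iff by (auto simp: col eqpoll_iff_card intro!: exI[of _ 0])
  ultimately show ?thesis
    by simp
qed

theorem theorem8p1:
  fixes pr :: "nat \<times> nat \<Rightarrow> nat"
  assumes "bij pr"
  shows "\<not> (quotient_topology cantor_space (eq_e pr)
              homeomorphic_space quotient_topology cantor_space (eq_f pr))"
proof
  have inj: "inj pr"
    using assms by (rule bij_is_inj)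
  let ?p = "eq_f pr `` {{pr (0, 0), pr (0, Suc 0)}}"
  assume "quotient_topology cantor_space (eq_e pr)
            homeomorphic_space quotient_topology cantor_space (eq_f pr)"
  \<comment> \<open>The homeomorphism is reversed so that it carries the three-point closure into
    the quotient by \<open>eq_e\<close>.\<close>
  then obtain h where h: "homeomorphic_map (quotient_topology cantor_space (eq_f pr))
      (quotient_topology cantor_space (eq_e pr)) h"
    using homeomorphic_space homeomorphic_space_sym by metis
  have p: "?p \<in> topspace (quotient_topology cantor_space (eq_f pr))"
    by (auto intro: quotientI)
  with h have "h ?p \<in> topspace (quotient_topology cantor_space (eq_e pr))"
    using homeomorphic_imp_surjective_map by blast
  then obtain A where "h ?p = eq_e pr `` {A}"
    by (auto elim: quotientE)
  then show False
    using homeomorphic_map_card_closure_of_singleton[OF h p]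
      eq_f_card_closure_of_two_element_column[OF inj]
      eq_e_card_closure_of_singleton_ne_3[OF inj] by metis
qed

end
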